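(* Let $\mathcal{S}$ be a pointed category with weak kernels such that every map is a weak kernel. Let $\mathcal{P}$ be a collection of objects and $\mathcal{I}$ a collection of morphisms such that $\mathcal{P}\text{-null}=\mathcal{I}$ and $\mathcal{I}\text{-proj}=\mathcal{P}$. Assume also that for each object $X$ there is an object $P$ in $\mathcal{P}$ and a map $P\to X$ which is a weak kernel of a map in $\mathcal{I}$. Then $(\mathcal{P},\mathcal{P}\text{-exact})$ is a projective class (in the sense of Eilenberg and Moore). Moreover, every projective class is of this form for a unique pair $(\mathcal{P},\mathcal{I})$, consisting of a collection $\mathcal{P}$ of objects and a collection $\mathcal{I}$ of morphisms, such that $\mathcal{P}\text{-null}=\mathcal{I}$, $\mathcal{I}\text{-proj}=\mathcal{P}$, and for each object $X$ there is an object $P$ in $\mathcal{P}$ and a map $P\to X$ which is a weak kernel of a map in $\mathcal{I}$.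
   Context: A category is pointed if it has an object $0$ that is both initial and terminal; the zero map makes each hom set $\mathcal{S}(X,Y)$ a pointed set. A composable pair $X\to Y\to Z$ is a (length two) complex if the composite is zero. A sequence $A\xrightarrow{f}B\xrightarrow{g}C$ of pointed sets is exact if $f(A)=g^{-1}( * )$. A weak kernel of a map $f:X\to Y$ is a map $W\to X$ such that $\mathcal{S}(V,W)\to\mathcal{S}(V,X)\to\mathcal{S}(V,Y)$ is an exact sequence of pointed sets for every object $V$. $\mathcal{S}$ has weak kernels if every map has a weak kernel. For a collection $\mathcal{P}$ of objects, $\mathcal{P}\text{-exact}$ is the collection of complexes $X\to Y\to Z$ such that $\mathcal{S}(P,X)\to\mathcal{S}(P,Y)\to\mathcal{S}(P,Z)$ is exact for each $P$ in $\mathcal{P}$. For a collection $\mathcal{C}$ of length two complexes, $\mathcal{C}\text{-proj}$ is the collection of objects $P$ such that $\mathcal{S}(P,X)\to\mathcal{S}(P,Y)\to\mathcal{S}(P,Z)$ is exact for each complex $X\to Y\to Z$ in $\mathcal{C}$. A pair $(\mathcal{P},\mathcal{C})$ is a projective class (Eilenberg–Moore) if $\mathcal{P}\text{-exact}=\mathcal{C}$, $\mathcal{C}\text{-proj}=\mathcal{P}$, and for each morphism $X\to Y$ there is a morphism $P\to X$ with $P$ in $\mathcal{P}$ and $P\to X\to Y$ in $\mathcal{C}$. $\mathcal{P}\text{-null}$ is the collection of maps $X\to Y$ such that $\mathcal{S}(P,X)\to\mathcal{S}(P,Y)$ is the zero map for each $P$ in $\mathcal{P}$. For a collection $\mathcal{I}$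 of maps, $\mathcal{I}\text{-proj}$ is the collection of objects $P$ such that $\mathcal{S}(P,X)\to\mathcal{S}(P,Y)$ is the zero map for each map $X\to Y$ in $\mathcal{I}$. *)

theory Defs
  imports Main
begin

text \<open>Composition is written in the usual order: \<open>comp S g f\<close> is \<open>f\<close> followed by \<open>g\<close>.\<close>

record ('o, 'm) cat =
  obj :: "'o set"
  arr :: "'m set"
  src :: "'m \<Rightarrow> 'o"
  tgt :: "'m \<Rightarrow> 'o"
  ident :: "'o \<Rightarrow> 'm"
  comp :: "'m \<Rightarrow> 'm \<Rightarrow> 'm"

definition hom :: "('o, 'm) cat \<Rightarrow> 'o \<Rightarrow> 'o \<Rightarrow> 'm set" where
  "hom S X Y = {f \<in> arr S. src S f = X \<and> tgt S f = Y}"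

locale category =
  fixes S :: "('o, 'm) cat"
  assumes src_obj: "f \<in> arr S \<Longrightarrow> src S f \<in> obj S"
    and tgt_obj: "f \<in> arr S \<Longrightarrow> tgt S f \<in> obj S"
    and ident_hom: "X \<in> obj S \<Longrightarrow> ident S X \<in> hom S X X"
    and comp_hom: "f \<in> hom S X Y \<Longrightarrow> g \<in> hom S Y Z \<Longrightarrow> comp S g f \<in> hom S X Z"
    and comp_ident: "f \<in> hom S X Y \<Longrightarrow> comp S f (ident S X) = f"
    and ident_comp: "f \<in> hom S X Y \<Longrightarrow> comp S (ident S Y) f = f"
    and comp_assoc: "f \<in> hom S W X \<Longrightarrow> g \<in> hom S X Y \<Longrightarrow> h \<in> hom S Y Z \<Longrightarrow>
      comp S h (comp S g f) = comp S (comp S h g) f"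

definition initial :: "('o, 'm) cat \<Rightarrow> 'o \<Rightarrow> bool" where
  "initial S Z \<longleftrightarrow> Z \<in> obj S \<and> (\<forall>X\<in>obj S. \<exists>!f. f \<in> hom S Z X)"

definition terminal :: "('o, 'm) cat \<Rightarrow> 'o \<Rightarrow> bool" where
  "terminal S Z \<longleftrightarrow> Z \<in> obj S \<and> (\<forall>X\<in>obj S. \<exists>!f. f \<in> hom S X Z)"

definition zero_object :: "('o, 'm) cat \<Rightarrow> 'o \<Rightarrow> bool" where
  "zero_object S Z \<longleftrightarrow> initial S Z \<and> terminal S Z"

locale pointed_category = category S for S :: "('o, 'm) cat" +
  assumes ex_zero_object: "\<exists>Z. zero_object S Z"

definition zero_map :: "('o, 'm) cat \<Rightarrow> 'o \<Rightarrow> 'o \<Rightarrow> 'm" where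
  "zero_map S X Y = (THE f. \<exists>Z g h. zero_object S Z \<and> g \<in> hom S X Z \<and> h \<in> hom S Z Y
     \<and> f = comp S h g)"

text \<open>The zero map does not depend on the zero object it is factored through.\<close>

lemma (in pointed_category) zero_map_eq:
  assumes Z: "zero_object S Z" and g: "g \<in> hom S X Z" and h: "h \<in> hom S Z Y"
  shows "zero_map S X Y = comp S h g"
  unfolding zero_map_def
proof (rule the_equality)
  show "\<exists>Z g' h'. zero_object S Z \<and> g' \<in> hom S X Z \<and> h' \<in> hom S Z Y
     \<and> comp S h g = comp S h' g'"
    using assms by blast
next
  fix f
  assume "\<exists>Z g h. zero_object S Z \<and> g \<in> hom S X Z \<and> h \<in> hom S Z Y \<and> f = comp S h g"
  then obtain Z' g' h' where Z': "zero_object S Z'" and g': "g' \<in> hom S X Z'"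
    and h': "h' \<in> hom S Z' Y" and f: "f = comp S h' g'" by blast
  have X: "X \<in> obj S" using g src_obj by (auto simp: hom_def)
  have Y: "Y \<in> obj S" using h tgt_obj by (auto simp: hom_def)
  have ZO: "Z \<in> obj S" using Z by (auto simp: zero_object_def initial_def)
  obtain t where t: "t \<in> hom S Z' Z"
    using Z' ZO unfolding zero_object_def initial_def by blast
  have a: "comp S t g' = g"
    using Z X g comp_hom[OF g' t] unfolding zero_object_def terminal_def by blast
  have b: "comp S h t = h'"
    using Z' Y h' comp_hom[OF t h] unfolding zero_object_def initial_def by blast
  show "f = comp S h g"
    using f a b comp_assoc[OF g' t h] by simp
qed

text \<open>Exactness of \<open>A \<rightarrow> B \<rightarrow> C\<close> at \<open>B\<close>, where \<open>c\<close> is the base point of \<open>C\<close>; the other base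
  points do not enter.\<close>

definition exact_pointed :: "'a set \<Rightarrow> 'b set \<Rightarrow> ('a \<Rightarrow> 'b) \<Rightarrow> ('b \<Rightarrow> 'c) \<Rightarrow> 'c \<Rightarrow> bool" where
  "exact_pointed A B f g c \<longleftrightarrow> f ` A = {b \<in> B. g b = c}"

text \<open>For composable \<open>f\<close> and \<open>g\<close>: exactness of the sequence obtained by applying \<open>S(V,-)\<close>.\<close>

definition hom_exact :: "('o, 'm) cat \<Rightarrow> 'o \<Rightarrow> 'm \<Rightarrow> 'm \<Rightarrow> bool" where
  "hom_exact S V f g \<longleftrightarrow>
     exact_pointed (hom S V (src S f)) (hom S V (src S g)) (comp S f) (comp S g)
       (zero_map S V (tgt S g))"

definition hom_null :: "('o, 'm) cat \<Rightarrow> 'o \<Rightarrow> 'm \<Rightarrow> bool" where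
  "hom_null S V f \<longleftrightarrow> (\<forall>u\<in>hom S V (src S f). comp S f u = zero_map S V (tgt S f))"

definition weak_kernel :: "('o, 'm) cat \<Rightarrow> 'm \<Rightarrow> 'm \<Rightarrow> bool" where
  "weak_kernel S w f \<longleftrightarrow> w \<in> arr S \<and> f \<in> arr S \<and> tgt S w = src S f
     \<and> (\<forall>V\<in>obj S. hom_exact S V w f)"

definition has_weak_kernels :: "('o, 'm) cat \<Rightarrow> bool" where
  "has_weak_kernels S \<longleftrightarrow> (\<forall>f\<in>arr S. \<exists>w. weak_kernel S w f)"

definition every_map_weak_kernel :: "('o, 'm) cat \<Rightarrow> bool" where
  "every_map_weak_kernel S \<longleftrightarrow> (\<forall>w\<in>arr S. \<exists>f. weak_kernel S w f)"

text \<open>The pair \<open>(f, g)\<close> stands for \<open>X \<rightarrow> Y \<rightarrow> Z\<close> with first map \<open>f\<close> and second map \<open>g\<close>.\<close>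

definition complexes :: "('o, 'm) cat \<Rightarrow> ('m \<times> 'm) set" where
  "complexes S = {(f, g). f \<in> arr S \<and> g \<in> arr S \<and> tgt S f = src S g
     \<and> comp S g f = zero_map S (src S f) (tgt S g)}"

definition exact_of :: "('o, 'm) cat \<Rightarrow> 'o set \<Rightarrow> ('m \<times> 'm) set" where
  "exact_of S \<P> = {(f, g) \<in> complexes S. \<forall>P\<in>\<P>. hom_exact S P f g}"

definition proj_of_complexes :: "('o, 'm) cat \<Rightarrow> ('m \<times> 'm) set \<Rightarrow> 'o set" where
  "proj_of_complexes S \<C> = {P \<in> obj S. \<forall>(f, g)\<in>\<C>. hom_exact S P f g}"

definition null_of :: "('o, 'm) cat \<Rightarrow> 'o set \<Rightarrow> 'm set" where
  "null_of S \<P> = {f \<in> arr S. \<forall>P\<in>\<P>. hom_null S P f}"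

definition proj_of_maps :: "('o, 'm) cat \<Rightarrow> 'm set \<Rightarrow> 'o set" where
  "proj_of_maps S \<I> = {P \<in> obj S. \<forall>f\<in>\<I>. hom_null S P f}"

definition projective_class :: "('o, 'm) cat \<Rightarrow> 'o set \<Rightarrow> ('m \<times> 'm) set \<Rightarrow> bool" where
  "projective_class S \<P> \<C> \<longleftrightarrow> \<P> \<subseteq> obj S \<and> \<C> \<subseteq> complexes S
     \<and> exact_of S \<P> = \<C> \<and> proj_of_complexes S \<C> = \<P>
     \<and> (\<forall>f\<in>arr S. \<exists>P\<in>\<P>. \<exists>p\<in>hom S P (src S f). (p, f) \<in> \<C>)"

definition ideal_projective_pair :: "('o, 'm) cat \<Rightarrow> 'o set \<Rightarrow> 'm set \<Rightarrow> bool" where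
  "ideal_projective_pair S \<P> \<I> \<longleftrightarrow> \<P> \<subseteq> obj S \<and> \<I> \<subseteq> arr S
     \<and> null_of S \<P> = \<I> \<and> proj_of_maps S \<I> = \<P>
     \<and> (\<forall>X\<in>obj S. \<exists>P\<in>\<P>. \<exists>p\<in>hom S P X. \<exists>i\<in>\<I>. weak_kernel S p i)"

end

theory Submission imports Defs begin

text \<open>
  A projective class can be described by its objects together with either the complexes they
  see as exact or the maps they see as zero. The proof translates between the two notions of
  projectivity, and the translation rests on turning an arbitrary map into half of an exact
  sequence.

  Every map \<open>f : X \<rightarrow> Y\<close> is a weak kernel of some \<open>g : Y \<rightarrow> Z\<close>, and then the maps into \<open>Y\<close>
  killed by \<open>g\<close> are those that factor through \<open>f\<close>. So \<open>f\<close> is null on an object \<open>Q\<close> exactly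
  when \<open>0 \<rightarrow> Y \<rightarrow> Z\<close> is exact on \<open>Q\<close>. Hence an object that is projective for the
  \<open>\<P>\<close>-exact complexes is projective for the \<open>\<P>\<close>-null maps (\<open>proj_of_exact_subset\<close>). Conversely,
  for a complex \<open>X \<rightarrow> Y \<rightarrow> Z\<close> with maps \<open>f\<close> and \<open>g\<close>, let \<open>w : W \<rightarrow> Y\<close> be a weak kernel of \<open>g\<close>
  and let \<open>f\<close> be a weak kernel of \<open>h\<close>. Then \<open>h w\<close> is null on an object exactly when the complex
  is exact on it, so an object that is projective for the \<open>\<P>\<close>-null maps is projective for the
  \<open>\<P>\<close>-exact complexes (\<open>proj_of_null_subset\<close>).

  The two conditions of having enough projectives correspond as follows. Covering a weak kernel
  of \<open>f\<close> by an object of \<open>\<P>\<close> gives an exact \<open>P \<rightarrow> X \<rightarrow> Y\<close> (\<open>enough_exact\<close>). In the other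
  direction, exactness of \<open>P \<rightarrow> X \<rightarrow> 0\<close> says that \<open>P \<rightarrow> X\<close> is surjective on \<open>\<P>\<close>, so that a map
  of which it is a weak kernel, and there is one, is \<open>\<P>\<close>-null (\<open>enough_null\<close>).
  Uniqueness of the pair is clear, because \<open>\<P>\<close> is part of the projective class and \<open>\<I>\<close> must be the collection of \<open>\<P>\<close>-null
  maps.
\<close>

section \<open>Zero maps\<close>

lemma hom_src: "f \<in> hom S X Y \<Longrightarrow> src S f = X"
  and hom_tgt: "f \<in> hom S X Y \<Longrightarrow> tgt S f = Y"
  by (simp_all add: hom_def)

lemma arr_hom: "f \<in> arr S \<Longrightarrow> f \<in> hom S (src S f) (tgt S f)"
  by (simp add: hom_def)

lemma (in category) hom_obj:
  assumes "f \<in> hom S X Y"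
  shows "X \<in> obj S" "Y \<in> obj S" "f \<in> arr S"
  using assms src_obj tgt_obj by (auto simp: hom_def)

context pointed_category
begin

lemma zero_map_factors:
  assumes "X \<in> obj S" "Y \<in> obj S" "zero_object S Z"
  obtains g h where "g \<in> hom S X Z" "h \<in> hom S Z Y" "zero_map S X Y = comp S h g"
proof -
  obtain g h where "g \<in> hom S X Z" "h \<in> hom S Z Y"
    using assms unfolding zero_object_def initial_def terminal_def by blast
  then show ?thesis using that zero_map_eq[OF assms(3)] by blast
qed

lemma zero_map_hom:
  assumes "X \<in> obj S" "Y \<in> obj S"
  shows "zero_map S X Y \<in> hom S X Y"
proof -
  obtain Z where "zero_object S Z" using ex_zero_object by blast
  then obtain g h where "g \<in> hom S X Z" "h \<in> hom S Z Y" "zero_map S X Y = comp S h g"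
    using zero_map_factors[OF assms] by blast
  then show ?thesis using comp_hom by simp
qed

lemma comp_zero_map:
  assumes "X \<in> obj S" "f \<in> hom S Y Z"
  shows "comp S f (zero_map S X Y) = zero_map S X Z"
proof -
  obtain O' where O: "zero_object S O'" using ex_zero_object by blast
  obtain g h where gh: "g \<in> hom S X O'" "h \<in> hom S O' Y" "zero_map S X Y = comp S h g"
    using zero_map_factors[OF assms(1) hom_obj(1)[OF assms(2)] O] .
  show ?thesis
    using zero_map_eq[OF O gh(1) comp_hom[OF gh(2) assms(2)]] gh comp_assoc[OF gh(1,2) assms(2)]
    by simp
qed

lemma zero_map_comp:
  assumes "Z \<in> obj S" "f \<in> hom S X Y"
  shows "comp S (zero_map S Y Z) f = zero_map S X Z"
proof -
  obtain O' where O: "zero_object S O'" using ex_zero_object by blast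
  obtain g h where gh: "g \<in> hom S Y O'" "h \<in> hom S O' Z" "zero_map S Y Z = comp S h g"
    using zero_map_factors[OF hom_obj(2)[OF assms(2)] assms(1) O] .
  show ?thesis
    using zero_map_eq[OF O comp_hom[OF assms(2) gh(1)] gh(2)] gh comp_assoc[OF assms(2) gh(1,2)]
    by simp
qed

lemma hom_to_zero:
  assumes O: "zero_object S Z" and f: "f \<in> hom S X Z"
  shows "f = zero_map S X Z"
  using assms hom_obj[OF f] zero_map_hom unfolding zero_object_def terminal_def by blast

lemma comp_eq_zero_assoc:
  assumes "f \<in> hom S X Y" "g \<in> hom S Y Z" "comp S g f = zero_map S X Z" "u \<in> hom S V X"
  shows "comp S g (comp S f u) = zero_map S V Z"
  using assms comp_assoc[OF assms(4,1,2)] zero_map_comp[OF hom_obj(2)[OF assms(2)] assms(4)]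
  by simp

section \<open>Exactness and weak kernels as lifting properties\<close>

lemma hom_null_iff:
  assumes "f \<in> hom S X Y"
  shows "hom_null S V f \<longleftrightarrow> (\<forall>u\<in>hom S V X. comp S f u = zero_map S V Y)"
  by (simp add: hom_null_def hom_src[OF assms] hom_tgt[OF assms])

lemma complexes_iff:
  assumes "f \<in> hom S X Y" "g \<in> hom S Y Z"
  shows "(f, g) \<in> complexes S \<longleftrightarrow> comp S g f = zero_map S X Z"
  using assms by (auto simp: complexes_def hom_def)

lemma complexesE:
  assumes "(f, g) \<in> complexes S"
  obtains X Y Z where "f \<in> hom S X Y" "g \<in> hom S Y Z" "comp S g f = zero_map S X Z"
  using assms by (auto simp: complexes_def hom_def)

text \<open>Since \<open>g f\<close> is zero, the image of \<open>S(V,f)\<close> lies in the kernel of \<open>S(V,g)\<close>, and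
  exactness reduces to a lifting property.\<close>

lemma complex_hom_exact_iff:
  assumes f: "f \<in> hom S X Y" and g: "g \<in> hom S Y Z" and gf: "comp S g f = zero_map S X Z"
  shows "hom_exact S V f g \<longleftrightarrow>
    (\<forall>u\<in>hom S V Y. comp S g u = zero_map S V Z \<longrightarrow> (\<exists>t\<in>hom S V X. u = comp S f t))"
proof -
  have "comp S f ` hom S V X \<subseteq> {u \<in> hom S V Y. comp S g u = zero_map S V Z}"
    using comp_hom[OF _ f] comp_eq_zero_assoc[OF f g gf] by blast
  then show ?thesis
    unfolding hom_exact_def exact_pointed_def hom_src[OF f] hom_src[OF g] hom_tgt[OF g] by blast
qed

lemma weak_kernel_hom:
  assumes "weak_kernel S w f" "f \<in> hom S X Y"
  obtains W where "w \<in> hom S W X"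
  using assms by (auto simp: weak_kernel_def hom_def)

lemma hom_weak_kernel:
  assumes "weak_kernel S w f" "w \<in> hom S W X"
  obtains Y where "f \<in> hom S X Y"
  using assms by (auto simp: weak_kernel_def hom_def)

text \<open>Exactness on the source of \<open>w\<close>, applied to the identity map.\<close>

lemma weak_kernel_comp:
  assumes k: "weak_kernel S w f" and w: "w \<in> hom S W X" and f: "f \<in> hom S X Y"
  shows "comp S f w = zero_map S W Y"
proof -
  have "hom_exact S W w f" using k hom_obj[OF w] by (auto simp: weak_kernel_def)
  moreover have "w \<in> comp S w ` hom S W W"
    using ident_hom[OF hom_obj(1)[OF w]] comp_ident[OF w] by force
  ultimately show ?thesis
    unfolding hom_exact_def exact_pointed_def hom_src[OF w] hom_src[OF f] hom_tgt[OF f] by blast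
qed

lemma weak_kernel_lift:
  assumes k: "weak_kernel S w f" and w: "w \<in> hom S W X" and f: "f \<in> hom S X Y"
    and u: "u \<in> hom S V X" and z: "comp S f u = zero_map S V Y"
  obtains t where "t \<in> hom S V W" "u = comp S w t"
proof -
  have "hom_exact S V w f" using k hom_obj[OF u] by (auto simp: weak_kernel_def)
  then show ?thesis
    using complex_hom_exact_iff[OF w f weak_kernel_comp[OF k w f]] u z that by blast
qed

lemma exact_of_complexes: "exact_of S \<P> \<subseteq> complexes S"
  by (auto simp: exact_of_def)

section \<open>Projectives for exact complexes and for null maps\<close>

text \<open>A \<open>\<P>\<close>-null map \<open>f : X \<rightarrow> Y\<close> that is a weak kernel of \<open>g : Y \<rightarrow> Z\<close> makes \<open>0 \<rightarrow> Y \<rightarrow> Z\<close>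
  a \<open>\<P>\<close>-exact complex, and exactness of that complex on \<open>Q\<close> forces \<open>f\<close> to be null on \<open>Q\<close>.\<close>

lemma proj_of_exact_subset:
  assumes ek: "every_map_weak_kernel S"
  shows "proj_of_complexes S (exact_of S \<P>) \<subseteq> proj_of_maps S (null_of S \<P>)"
proof
  fix Q
  assume Q: "Q \<in> proj_of_complexes S (exact_of S \<P>)"
  have "hom_null S Q f" if fI: "f \<in> null_of S \<P>" for f
  proof -
    have "f \<in> arr S" using fI by (simp add: null_of_def)
    then obtain X Y where f: "f \<in> hom S X Y" using arr_hom[of f S] by blast
    obtain g where k: "weak_kernel S f g"
      using ek hom_obj[OF f] by (auto simp: every_map_weak_kernel_def)
    obtain Z where g: "g \<in> hom S Y Z" using hom_weak_kernel[OF k f] .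
    obtain O' where O: "zero_object S O'" using ex_zero_object by blast
    have Oobj: "O' \<in> obj S" using O by (simp add: zero_object_def initial_def)
    let ?z = "zero_map S O' Y"
    have z: "?z \<in> hom S O' Y" using zero_map_hom[OF Oobj hom_obj(2)[OF f]] .
    have gz: "comp S g ?z = zero_map S O' Z" using comp_zero_map[OF Oobj g] .
    have "hom_exact S P ?z g" if P: "P \<in> \<P>" for P
      unfolding complex_hom_exact_iff[OF z g gz]
    proof (intro ballI impI)
      fix u assume u: "u \<in> hom S P Y" and gu: "comp S g u = zero_map S P Z"
      obtain t where t: "t \<in> hom S P X" "u = comp S f t" using weak_kernel_lift[OF k f g u gu] .
      have u0: "u = zero_map S P Y"
        using fI P t hom_null_iff[OF f] by (auto simp: null_of_def)
      have Pobj: "P \<in> obj S" using hom_obj[OF u] by blast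
      show "\<exists>s\<in>hom S P O'. u = comp S ?z s"
      proof
        show "zero_map S P O' \<in> hom S P O'" using zero_map_hom[OF Pobj Oobj] .
        show "u = comp S ?z (zero_map S P O')" using u0 comp_zero_map[OF Pobj z] by simp
      qed
    qed
    then have "(?z, g) \<in> exact_of S \<P>"
      using gz complexes_iff[OF z g] by (auto simp: exact_of_def)
    then have ex: "hom_exact S Q ?z g" using Q by (auto simp: proj_of_complexes_def)
    show ?thesis
      unfolding hom_null_iff[OF f]
    proof
      fix u assume u: "u \<in> hom S Q X"
      have "comp S g (comp S f u) = zero_map S Q Z"
        using comp_eq_zero_assoc[OF f g weak_kernel_comp[OF k f g] u] .
      then obtain s where s: "s \<in> hom S Q O'" "comp S f u = comp S ?z s"
        using ex complex_hom_exact_iff[OF z g gz] comp_hom[OF u f] by blast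
      then show "comp S f u = zero_map S Q Y"
        using zero_map_comp[OF hom_obj(2)[OF f] s(1)] by simp
    qed
  qed
  then show "Q \<in> proj_of_maps S (null_of S \<P>)"
    using Q by (auto simp: proj_of_maps_def proj_of_complexes_def)
qed

text \<open>For a complex with maps \<open>f\<close> and \<open>g\<close>, let \<open>w\<close> be a weak kernel of \<open>g\<close>, and let \<open>f\<close> be a
  weak kernel of \<open>h\<close>. The maps killed by \<open>g\<close> are those through \<open>w\<close>, and the maps through \<open>f\<close> are
  those killed by \<open>h\<close>; so \<open>h w\<close> measures the failure of exactness.\<close>

lemma proj_of_null_subset:
  assumes wk: "has_weak_kernels S" and ek: "every_map_weak_kernel S"
  shows "proj_of_maps S (null_of S \<P>) \<subseteq> proj_of_complexes S (exact_of S \<P>)"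
proof
  fix Q
  assume Q: "Q \<in> proj_of_maps S (null_of S \<P>)"
  have "hom_exact S Q f g" if C: "(f, g) \<in> exact_of S \<P>" for f g
  proof -
    obtain X Y Z where f: "f \<in> hom S X Y" and g: "g \<in> hom S Y Z"
      and gf: "comp S g f = zero_map S X Z"
      using C exact_of_complexes complexesE by blast
    obtain w where kw: "weak_kernel S w g"
      using wk hom_obj[OF g] by (auto simp: has_weak_kernels_def)
    obtain W where w: "w \<in> hom S W Y" using weak_kernel_hom[OF kw g] .
    obtain h where kf: "weak_kernel S f h"
      using ek hom_obj[OF f] by (auto simp: every_map_weak_kernel_def)
    obtain V where h: "h \<in> hom S Y V" using hom_weak_kernel[OF kf f] .
    note hf = weak_kernel_comp[OF kf f h]
    note gw = weak_kernel_comp[OF kw w g]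
    have hw: "comp S h w \<in> hom S W V" using comp_hom[OF w h] .
    have "hom_null S P (comp S h w)" if P: "P \<in> \<P>" for P
      unfolding hom_null_iff[OF hw]
    proof
      fix v assume v: "v \<in> hom S P W"
      have "hom_exact S P f g" using C P by (auto simp: exact_of_def)
      then obtain t where t: "t \<in> hom S P X" "comp S w v = comp S f t"
        using complex_hom_exact_iff[OF f g gf] comp_hom[OF v w]
          comp_eq_zero_assoc[OF w g gw v] by blast
      show "comp S (comp S h w) v = zero_map S P V"
        using comp_assoc[OF v w h] t(2) comp_eq_zero_assoc[OF f h hf t(1)] by simp
    qed
    then have "comp S h w \<in> null_of S \<P>" using hom_obj[OF hw] by (auto simp: null_of_def)
    then have null: "hom_null S Q (comp S h w)" using Q by (auto simp: proj_of_maps_def)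
    show ?thesis
      unfolding complex_hom_exact_iff[OF f g gf]
    proof (intro ballI impI)
      fix u assume u: "u \<in> hom S Q Y" and gu: "comp S g u = zero_map S Q Z"
      obtain v where v: "v \<in> hom S Q W" "u = comp S w v" using weak_kernel_lift[OF kw w g u gu] .
      have "comp S h u = zero_map S Q V"
        using null v comp_assoc[OF v(1) w h] hom_null_iff[OF hw] by simp
      then show "\<exists>t\<in>hom S Q X. u = comp S f t" using weak_kernel_lift[OF kf f h u] by blast
    qed
  qed
  then show "Q \<in> proj_of_complexes S (exact_of S \<P>)"
    using Q by (auto simp: proj_of_maps_def proj_of_complexes_def)
qed

lemma proj_of_exact_eq_proj_of_null:
  assumes "has_weak_kernels S" "every_map_weak_kernel S"
  shows "proj_of_complexes S (exact_of S \<P>) = proj_of_maps S (null_of S \<P>)"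
  using proj_of_exact_subset proj_of_null_subset assms by blast

section \<open>Enough projectives\<close>

text \<open>The projective \<open>P\<close> is obtained by covering a weak kernel \<open>W \<rightarrow> X\<close> of \<open>f\<close>. A map from \<open>\<P>\<close>
  to \<open>X\<close> that \<open>f\<close> kills lifts to \<open>W\<close>, and from there to \<open>P\<close> because the map \<open>i\<close> out of \<open>W\<close> is
  null.\<close>

lemma enough_exact:
  assumes wk: "has_weak_kernels S"
    and enough: "\<And>X. X \<in> obj S \<Longrightarrow> \<exists>P\<in>\<P>. \<exists>p\<in>hom S P X. \<exists>i\<in>null_of S \<P>. weak_kernel S p i"
    and f: "f \<in> hom S X Y"
  shows "\<exists>P\<in>\<P>. \<exists>p\<in>hom S P X. (p, f) \<in> exact_of S \<P>"
proof -
  obtain w where kw: "weak_kernel S w f"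
    using wk hom_obj[OF f] by (auto simp: has_weak_kernels_def)
  obtain W where w: "w \<in> hom S W X" using weak_kernel_hom[OF kw f] .
  obtain P p i where P: "P \<in> \<P>" and p: "p \<in> hom S P W" and iI: "i \<in> null_of S \<P>"
    and kp: "weak_kernel S p i"
    using enough hom_obj[OF w] by blast
  obtain V where i: "i \<in> hom S W V" using hom_weak_kernel[OF kp p] .
  have wp: "comp S w p \<in> hom S P X" using comp_hom[OF p w] .
  have fwp: "comp S f (comp S w p) = zero_map S P Y"
    using comp_eq_zero_assoc[OF w f weak_kernel_comp[OF kw w f] p] .
  have "hom_exact S P' (comp S w p) f" if P': "P' \<in> \<P>" for P'
    unfolding complex_hom_exact_iff[OF wp f fwp]
  proof (intro ballI impI)
    fix u assume u: "u \<in> hom S P' X" and fu: "comp S f u = zero_map S P' Y"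
    obtain v where v: "v \<in> hom S P' W" "u = comp S w v" using weak_kernel_lift[OF kw w f u fu] .
    have "comp S i v = zero_map S P' V"
      using iI P' v(1) hom_null_iff[OF i] by (auto simp: null_of_def)
    then obtain t where t: "t \<in> hom S P' P" "v = comp S p t"
      using weak_kernel_lift[OF kp p i v(1)] by blast
    show "\<exists>t\<in>hom S P' P. u = comp S (comp S w p) t"
      using t v comp_assoc[OF t(1) p w] by blast
  qed
  then have "(comp S w p, f) \<in> exact_of S \<P>"
    using fwp complexes_iff[OF wp f] by (auto simp: exact_of_def)
  then show ?thesis using P wp by blast
qed

text \<open>The exact sequence \<open>P \<rightarrow> X \<rightarrow> 0\<close> makes every map from \<open>\<P>\<close> to \<open>X\<close> factor through \<open>p\<close>, and a
  map \<open>i\<close> having \<open>p\<close> as a weak kernel kills \<open>p\<close>.\<close>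

lemma enough_null:
  assumes ek: "every_map_weak_kernel S"
    and enough: "\<And>f. f \<in> arr S \<Longrightarrow> \<exists>P\<in>\<P>. \<exists>p\<in>hom S P (src S f). (p, f) \<in> exact_of S \<P>"
    and X: "X \<in> obj S"
  shows "\<exists>P\<in>\<P>. \<exists>p\<in>hom S P X. \<exists>i\<in>null_of S \<P>. weak_kernel S p i"
proof -
  obtain O' where O: "zero_object S O'" using ex_zero_object by blast
  then obtain f where f: "f \<in> hom S X O'"
    using X unfolding zero_object_def terminal_def by blast
  obtain P p where P: "P \<in> \<P>" and p: "p \<in> hom S P X" and ex: "(p, f) \<in> exact_of S \<P>"
    using enough[OF hom_obj(3)[OF f]] unfolding hom_src[OF f] by blast
  obtain i where k: "weak_kernel S p i"
    using ek hom_obj[OF p] by (auto simp: every_map_weak_kernel_def)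
  obtain Y where i: "i \<in> hom S X Y" using hom_weak_kernel[OF k p] .
  have fp: "comp S f p = zero_map S P O'" using hom_to_zero[OF O comp_hom[OF p f]] .
  have "hom_null S P' i" if P': "P' \<in> \<P>" for P'
    unfolding hom_null_iff[OF i]
  proof
    fix u assume u: "u \<in> hom S P' X"
    have "hom_exact S P' p f" using ex P' by (auto simp: exact_of_def)
    then obtain t where t: "t \<in> hom S P' P" "u = comp S p t"
      using complex_hom_exact_iff[OF p f fp] u hom_to_zero[OF O comp_hom[OF u f]] by blast
    show "comp S i u = zero_map S P' Y"
      using comp_eq_zero_assoc[OF p i weak_kernel_comp[OF k p i] t(1)] t(2) by simp
  qed
  then have "i \<in> null_of S \<P>" using hom_obj[OF i] by (auto simp: null_of_def)
  then show ?thesis using P p k by blast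
qed

section \<open>Projective classes and pairs of objects and null maps\<close>

lemma ideal_projective_pair_imp_projective_class:
  assumes wk: "has_weak_kernels S" and ek: "every_map_weak_kernel S"
    and pair: "ideal_projective_pair S \<P> \<I>"
  shows "projective_class S \<P> (exact_of S \<P>)"
proof -
  have I: "\<I> = null_of S \<P>" and P: "\<P> \<subseteq> obj S" "proj_of_maps S \<I> = \<P>"
    and enough: "\<And>X. X \<in> obj S \<Longrightarrow> \<exists>P\<in>\<P>. \<exists>p\<in>hom S P X. \<exists>i\<in>null_of S \<P>. weak_kernel S p i"
    using pair unfolding ideal_projective_pair_def by blast+
  have "proj_of_complexes S (exact_of S \<P>) = \<P>"
    using proj_of_exact_eq_proj_of_null[OF wk ek] I P by simp
  moreover have "\<forall>f\<in>arr S. \<exists>P\<in>\<P>. \<exists>p\<in>hom S P (src S f). (p, f) \<in> exact_of S \<P>"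
    using enough_exact[OF wk enough arr_hom] by blast
  ultimately show ?thesis
    using P exact_of_complexes by (simp add: projective_class_def)
qed

lemma projective_class_imp_ideal_projective_pair:
  assumes wk: "has_weak_kernels S" and ek: "every_map_weak_kernel S"
    and pc: "projective_class S \<P> \<C>"
  shows "ideal_projective_pair S \<P> (null_of S \<P>)"
proof -
  have C: "\<C> = exact_of S \<P>" and P: "\<P> \<subseteq> obj S" "proj_of_complexes S \<C> = \<P>"
    and enough: "\<And>f. f \<in> arr S \<Longrightarrow> \<exists>P\<in>\<P>. \<exists>p\<in>hom S P (src S f). (p, f) \<in> exact_of S \<P>"
    using pc unfolding projective_class_def by blast+
  have "proj_of_maps S (null_of S \<P>) = \<P>"
    using proj_of_exact_eq_proj_of_null[OF wk ek] C P by simp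
  moreover have "\<forall>X\<in>obj S. \<exists>P\<in>\<P>. \<exists>p\<in>hom S P X. \<exists>i\<in>null_of S \<P>. weak_kernel S p i"
    using enough_null[OF ek enough] by blast
  moreover have "null_of S \<P> \<subseteq> arr S" by (auto simp: null_of_def)
  ultimately show ?thesis
    using P by (simp add: ideal_projective_pair_def)
qed

end

theorem proposition2p6:
  fixes S :: "('o, 'm) cat"
  assumes "pointed_category S"
    and "has_weak_kernels S"
    and "every_map_weak_kernel S"
  shows "(\<forall>\<P> \<I>. ideal_projective_pair S \<P> \<I> \<longrightarrow> projective_class S \<P> (exact_of S \<P>))
    \<and> (\<forall>\<P> \<C>. projective_class S \<P> \<C> \<longrightarrow>
         (\<exists>!Q. case Q of (\<P>', \<I>) \<Rightarrow>
            ideal_projective_pair S \<P>' \<I> \<and> (\<P>, \<C>) = (\<P>', exact_of S \<P>')))"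
proof (intro conjI allI impI)
  interpret pointed_category S by fact
  show "projective_class S \<P> (exact_of S \<P>)" if "ideal_projective_pair S \<P> \<I>" for \<P> \<I>
    using ideal_projective_pair_imp_projective_class[OF assms(2,3) that] .
  fix \<P> \<C>
  assume pc: "projective_class S \<P> \<C>"
  show "\<exists>!Q. case Q of (\<P>', \<I>) \<Rightarrow>
            ideal_projective_pair S \<P>' \<I> \<and> (\<P>, \<C>) = (\<P>', exact_of S \<P>')"
  proof (rule ex1I[where a = "(\<P>, null_of S \<P>)"])
    show "case (\<P>, null_of S \<P>) of (\<P>', \<I>) \<Rightarrow>
            ideal_projective_pair S \<P>' \<I> \<and> (\<P>, \<C>) = (\<P>', exact_of S \<P>')"
      using projective_class_imp_ideal_projective_pair[OF assms(2,3) pc] pc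
      by (simp add: projective_class_def)
  next
    fix Q
    assume "case Q of (\<P>', \<I>) \<Rightarrow>
            ideal_projective_pair S \<P>' \<I> \<and> (\<P>, \<C>) = (\<P>', exact_of S \<P>')"
    then show "Q = (\<P>, null_of S \<P>)"
      by (auto simp: ideal_projective_pair_def split: prod.splits)
  qed
qed

end
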